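(* For every $n\ge 1$ and every permutation $\pi\in S_n$, there is a tangle performing $\pi$ that has at most $5$ moves in each path.
   Context: $S_n$ is the symmetric group on $\{1,\ldots,n\}$; a permutation is written $\pi=[\pi(1),\ldots,\pi(n)]$, and $\mathrm{id}=[1,\ldots,n]$. Two permutations $\pi,\rho\in S_n$ are adjacent if $|\pi^{-1}(i)-\rho^{-1}(i)|\le 1$ for every $i\in\{1,\ldots,n\}$ (so equal permutations are adjacent). A tangle is a finite sequence $\pi_1,\ldots,\pi_N$ of permutations in $S_n$ in which each consecutive pair is adjacent. A tangle performs $\pi$ if its first permutation is $\mathrm{id}$ and its last is $\pi$. For an element $i$, path $i$ is the sequence of positions $\pi_1^{-1}(i),\pi_2^{-1}(i),\ldots,\pi_N^{-1}(i)$. A move of path $i$ is a maximal subsequence of at least two consecutive permutations of the tangle during which the positions of $i$ form an arithmetic progression of common difference $+1$, or of common difference $-1$. *)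

theory Defs
  imports "HOL-Combinatorics.Permutations"
begin

text \<open>
  The elements of the symmetric group on \<open>{1..n}\<close> are the functions \<open>p\<close> on the naturals with
  \<open>p permutes {1..n}\<close>; the position of the element \<open>i\<close> in \<open>p\<close> is \<open>inv p i\<close>.
\<close>

definition adjacent :: "nat \<Rightarrow> (nat \<Rightarrow> nat) \<Rightarrow> (nat \<Rightarrow> nat) \<Rightarrow> bool" where
  "adjacent n p q \<longleftrightarrow> (\<forall>i\<in>{1..n}. \<bar>int (inv p i) - int (inv q i)\<bar> \<le> 1)"

definition tangle :: "nat \<Rightarrow> (nat \<Rightarrow> nat) list \<Rightarrow> bool" where
  "tangle n T \<longleftrightarrow> T \<noteq> [] \<and> (\<forall>p\<in>set T. p permutes {1..n}) \<and>
     (\<forall>k. Suc k < length T \<longrightarrow> adjacent n (T ! k) (T ! Suc k))"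

definition performs :: "nat \<Rightarrow> (nat \<Rightarrow> nat) list \<Rightarrow> (nat \<Rightarrow> nat) \<Rightarrow> bool" where
  "performs n T p \<longleftrightarrow> tangle n T \<and> hd T = id \<and> last T = p"

definition positions_path :: "(nat \<Rightarrow> nat) list \<Rightarrow> nat \<Rightarrow> nat list" where
  "positions_path T i = map (\<lambda>p. inv p i) T"

text \<open>
  A block of at least two consecutive terms of \<open>xs\<close> is given by its first and last index
  \<open>a < b\<close>, counted from 0. The common difference \<open>d\<close> is the same throughout the block.
\<close>

definition unit_progression :: "nat list \<Rightarrow> nat \<Rightarrow> nat \<Rightarrow> bool" where
  "unit_progression xs a b \<longleftrightarrow> a < b \<and> b < length xs \<and>
     (\<exists>d\<in>{1, -1}. \<forall>k\<in>{a..<b}. int (xs ! Suc k) - int (xs ! k) = d)"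

text \<open>Moves are the blocks that are maximal with respect to inclusion.\<close>

definition moves :: "nat list \<Rightarrow> (nat \<times> nat) set" where
  "moves xs = {(a, b). unit_progression xs a b \<and>
     (\<forall>a' b'. unit_progression xs a' b' \<and> {a..b} \<subseteq> {a'..b'} \<longrightarrow> a' = a \<and> b' = b)}"

lemma finite_moves: "finite (moves xs)"
proof (rule finite_subset)
  show "moves xs \<subseteq> {..<length xs} \<times> {..<length xs}"
    by (auto simp: moves_def unit_progression_def)
qed simp

end

theory Submission
  imports Defs "HOL-Combinatorics.Cycles"
begin

text \<open>
  The inverse of \<open>\<pi>\<close> is a product \<open>b \<circ> a\<close> of two involutions: on a cycle these are two reflections
  of a polygon. Both swap only points of different colours for a suitable 2-colouring, since the
  swapped pairs of a cycle are the edges of a path.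

  Imagine \<open>n\<close> tokens on a conveyor belt wound around the interval: all travel forward on a circle of
  length \<open>2n\<close>, whose upper half moves right and whose lower half moves left. Token \<open>p\<close> rests at
  position \<open>p\<close>, travels once around the circle, and rests at \<open>p\<close> again. It sets off to the right or
  to the left according to its colour and makes three legs, separated by reflections at the two
  walls. With suitable departure times the tokens always occupy distinct positions, and two tokens
  of different colours cross exactly twice, each time on legs with the same number.

  Now let the elements ride on the tokens. If the riders of two crossing tokens stay where they are
  instead of crossing, they change tokens. Let the pairs of \<open>a\<close> do so at their first crossing and the
  pairs of \<open>b\<close> at their second; along every token all first crossings precede all second ones, so
  the rider of \<open>x\<close> ends on \<open>b (a x)\<close>. A change of tokens reverses the direction but keeps the number
  of the leg, so each element makes at most 3 + 2 moves.
\<close>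

section \<open>Products of two involutions\<close>

definition alternating_involution :: "'a set \<Rightarrow> 'a set \<Rightarrow> ('a \<Rightarrow> 'a) \<Rightarrow> bool" where
  "alternating_involution S C f \<longleftrightarrow>
     (\<forall>x\<in>S. f x \<in> S \<and> f (f x) = x \<and> (f x \<noteq> x \<longrightarrow> (f x \<in> C) \<noteq> (x \<in> C)))"

text \<open>The map is the reflection j -> c - j of Z/k; the added k keeps the natural subtraction
  from being truncated.\<close>

lemma reflection_mod_involutive:
  assumes "j < k" "c \<le> 1" shows "(k + c - (k + c - j) mod k) mod k = (j::nat)"
proof (cases "j < c")
  case True
  then have "c = 1" "j = 0" using assms by auto
  then show ?thesis using assms by (cases "k = 1") auto
next
  case False
  show ?thesis
  proof (cases "j = c")
    case True then show ?thesis using assms by (auto simp: mod_less)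
  next
    case 2: False
    then have "k + c - j < k" using assms False by linarith
    then show ?thesis using assms False by simp
  qed
qed

text \<open>The class is 1 to k/2. Apart from the pair 0, 1 exchanged for \<open>c = 1\<close>, a
  moved index and its image add up to k or k + 1; if both lay on the same side of k/2, they would
  coincide.\<close>

lemma reflection_mod_alternates:
  assumes "j < k" "c \<le> 1" and "(k + c - j) mod k \<noteq> j"
  shows "(1 \<le> (k + c - j) mod k \<and> 2 * ((k + c - j) mod k) \<le> k) \<noteq> (1 \<le> j \<and> 2 * j \<le> (k::nat))"
proof (cases "j \<le> c")
  case True
  consider "c = 0" "j = 0" | "c = 1" "j = 0" | "c = 1" "j = 1" using True assms by linarith
  then show ?thesis
  proof cases
    case 1 then show ?thesis using assms by simp
  next
    case 2 then show ?thesis using assms by (cases "k = 1") (auto simp: mod_Suc)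
  next
    case 3 then show ?thesis using assms by auto
  qed
next
  case False
  then have "(k + c - j) mod k = k + c - j" using assms by simp
  then show ?thesis using assms False by auto
qed

text \<open>Number the cycle by Z/k. The reflections j -> -j and j -> 1 - j compose to j -> 1 - (-j)
  = j + 1, one step along the cycle.\<close>

lemma cycle_alternating_involutions:
  assumes "distinct cs"
  shows "\<exists>C a b. alternating_involution (set cs) C a \<and> alternating_involution (set cs) C b \<and>
    (\<forall>x\<in>set cs. b (a x) = cycle_of_list cs x)"
proof -
  define k where "k = length cs"
  define f where "f = (!) cs"
  define g where "g = inv_into {..<k} f"
  have bij: "bij_betw f {..<k} (set cs)"
    unfolding f_def k_def using assms by (rule bij_betw_nth) auto
  have g: "g (f j) = j" if "j < k" for j
    using bij that by (simp add: g_def bij_betw_inv_into_left)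
  have f: "f j \<in> set cs" if "j < k" for j
    using that by (simp add: f_def k_def)
  have ex: "\<exists>j<k. x = f j" if "x \<in> set cs" for x
    using that by (auto simp: in_set_conv_nth f_def k_def)
  define C where "C = f ` {j. j < k \<and> 1 \<le> j \<and> 2 * j \<le> k}"
  have C: "f j \<in> C \<longleftrightarrow> 1 \<le> j \<and> 2 * j \<le> k" if "j < k" for j
    unfolding C_def using that bij by (auto simp: bij_betw_def inj_on_def)
  define r where "r c x = f ((k + c - g x) mod k)" for c x
  have r: "r c (f j) = f ((k + c - j) mod k)" if "j < k" for c j
    using that by (simp add: r_def g)
  have succ: "cycle_of_list cs (f j) = f (Suc j mod k)" if "j < k" for j
  proof -
    have "map (cycle_of_list cs) cs = rotate1 cs"
      using cyclic_rotation[OF assms, of 1] by simp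
    then have "map (cycle_of_list cs) cs ! j = rotate1 cs ! j" by simp
    then show ?thesis using that by (simp add: nth_rotate1 f_def k_def)
  qed
  have reflection: "r c x \<in> set cs \<and> r c (r c x) = x \<and> (r c x \<noteq> x \<longrightarrow> (r c x \<in> C) \<noteq> (x \<in> C))"
    if x: "x \<in> set cs" and c: "c \<le> 1" for c x
  proof -
    obtain j where j: "j < k" "x = f j" using ex x by blast
    have k: "(k + c - j) mod k < k" using j by simp
    have "r c x \<in> set cs" using r[OF j(1)] f[OF k] j by simp
    moreover have "r c (r c x) = x"
      using r[OF j(1), of c] r[OF k, of c] j reflection_mod_involutive[OF j(1) c] by simp
    moreover have "(r c x \<in> C) \<noteq> (x \<in> C)" if "r c x \<noteq> x"
    proof -
      have "(k + c - j) mod k \<noteq> j" using that r[OF j(1), of c] j by auto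
      from reflection_mod_alternates[OF j(1) c this] show ?thesis
        using r[OF j(1), of c] C[OF k] C[OF j(1)] j by simp
    qed
    ultimately show ?thesis by blast
  qed
  have "r 1 (r 0 x) = cycle_of_list cs x" if x: "x \<in> set cs" for x
  proof -
    obtain j where j: "j < k" "x = f j" using ex x by blast
    have k: "(k - j) mod k < k" using j by simp
    have "(k + 1 - (k - j) mod k) mod k = Suc j mod k"
      using j by (cases "j = 0") (auto simp: Suc_diff_le mod_Suc)
    then show ?thesis using r[OF j(1), of 0] r[OF k, of 1] j succ[OF j(1)] by simp
  qed
  with reflection show ?thesis unfolding alternating_involution_def
    by (intro exI[of _ C] exI[of _ "r 0"] exI[of _ "r 1"]) auto
qed

text \<open>The cycles have disjoint supports, so their involutions and colourings can be
  glued.\<close>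

lemma permutes_alternating_involutions:
  assumes "p permutes S" "finite S"
  shows "\<exists>C a b. alternating_involution S C a \<and> alternating_involution S C b \<and> (\<forall>x\<in>S. b (a x) = p x)"
  using cycle_decomposition[OF assms]
proof induction
  case empty
  show ?case by (simp add: alternating_involution_def)
next
  case (comp I p cs)
  obtain C a b where 1: "alternating_involution I C a" "alternating_involution I C b"
      "\<forall>x\<in>I. b (a x) = p x"
    using comp by blast
  obtain C' a' b' where 2: "alternating_involution (set cs) C' a'" "alternating_involution (set cs) C' b'"
      "\<forall>x\<in>set cs. b' (a' x) = cycle_of_list cs x"
    using cycle_alternating_involutions comp by metis
  have p: "p x = x" if "x \<notin> I" for x
    using comp.hyps(1) that by induction (auto simp: id_outside_supp)
  let ?C = "C' \<inter> set cs \<union> (C - set cs)"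
  define u where "u f g x = (if x \<in> set cs then f x else g x)" for f g :: "'a \<Rightarrow> 'a" and x
  have join: "alternating_involution (set cs \<union> I) ?C (u f g)"
    if f: "alternating_involution (set cs) C' f" and g: "alternating_involution I C g" for f g
    unfolding alternating_involution_def
  proof
    fix x assume x: "x \<in> set cs \<union> I"
    show "u f g x \<in> set cs \<union> I \<and> u f g (u f g x) = x \<and> (u f g x \<noteq> x \<longrightarrow> (u f g x \<in> ?C) \<noteq> (x \<in> ?C))"
    proof (cases "x \<in> set cs")
      case True
      then show ?thesis using f by (simp add: alternating_involution_def u_def)
    next
      case False
      then have "x \<in> I" "g x \<in> I" using x g by (auto simp: alternating_involution_def)
      moreover from this have "g x \<notin> set cs" using comp by auto
      ultimately show ?thesis using False g by (simp add: alternating_involution_def u_def)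
    qed
  qed
  have "u b' b (u a' a x) = (cycle_of_list cs \<circ> p) x" if x: "x \<in> set cs \<union> I" for x
  proof (cases "x \<in> set cs")
    case True
    then have "x \<notin> I" using comp by auto
    then show ?thesis using True 2 p by (simp add: alternating_involution_def u_def)
  next
    case False
    then have "x \<in> I" using x by simp
    then have "a x \<in> I" using 1(1) by (simp add: alternating_involution_def)
    then have "b (a x) \<in> I" using 1(2) by (simp add: alternating_involution_def)
    moreover from \<open>a x \<in> I\<close> this have "a x \<notin> set cs" "b (a x) \<notin> set cs" using comp by auto
    ultimately show ?thesis using False 1(3) \<open>x \<in> I\<close> by (simp add: u_def id_outside_supp)
  qed
  with join 1 2 show ?case by blast
qed

section \<open>Counting moves\<close>

text \<open>\<open>K\<close> labels times by stages. A step that changes the position keeps the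
  label, so each move has one label. Between two moves with equal labels the path never rests or
  turns, so both lie in one progression and, by maximality, are equal. Hence the label is injective
  on moves.\<close>

lemma card_moves_le:
  fixes K :: "nat \<Rightarrow> nat"
  assumes bound: "\<And>k. k < length xs \<Longrightarrow> K k < N"
    and turn: "\<And>k. Suc k < length xs \<Longrightarrow> K k \<noteq> K (Suc k) \<Longrightarrow> xs ! Suc k = xs ! k"
    and stage: "\<And>i j k. i \<le> j \<Longrightarrow> j \<le> k \<Longrightarrow> Suc k < length xs \<Longrightarrow> K i = K (Suc k) \<Longrightarrow>
      xs ! Suc i \<noteq> xs ! i \<Longrightarrow> xs ! Suc k \<noteq> xs ! k \<Longrightarrow>
      int (xs ! Suc j) - int (xs ! j) = int (xs ! Suc i) - int (xs ! i)"
  shows "card (moves xs) \<le> N"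
proof -
  have moving: "xs ! Suc k \<noteq> xs ! k" if up: "unit_progression xs a b" and k: "a \<le> k" "k < b" for a b k
  proof -
    obtain d where "d \<in> {1, -1}" "\<forall>k\<in>{a..<b}. int (xs ! Suc k) - int (xs ! k) = d"
      using up unfolding unit_progression_def by blast
    moreover from this(2) k have "int (xs ! Suc k) - int (xs ! k) = d" by simp
    ultimately show ?thesis by auto
  qed
  have const: "K b = K a" if up: "unit_progression xs a b" for a b
  proof -
    have ab: "a < b" "b < length xs" using up by (simp_all add: unit_progression_def)
    have "j \<le> b - a \<Longrightarrow> K (a + j) = K a" for j
    proof (induction j)
      case (Suc j)
      then have "a + j < b" by simp
      then have "K (Suc (a + j)) = K (a + j)"
        using turn[of "a + j"] moving[OF up, of "a + j"] ab by fastforce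
      then show ?case using Suc by simp
    qed simp
    from this[of "b - a"] show ?thesis using ab by simp
  qed
  have merge: "(a, b) = (a', b')"
    if m: "(a, b) \<in> moves xs" "(a', b') \<in> moves xs" "K a = K a'" and le: "a \<le> a'" for a b a' b'
  proof -
    have up: "unit_progression xs a b" "unit_progression xs a' b'"
      using m by (auto simp: moves_def)
    have ends: "a < b" "b < length xs" "a' < b'" "b' < length xs"
      using up by (simp_all add: unit_progression_def)
    obtain d where d: "d \<in> {1, -1}" "\<forall>k\<in>{a..<b}. int (xs ! Suc k) - int (xs ! k) = d"
      using up(1) unfolding unit_progression_def by blast
    then have da: "int (xs ! Suc a) - int (xs ! a) = d" using ends by simp
    have ne: "xs ! Suc a \<noteq> xs ! a" using moving[OF up(1)] ends by simp
    have ne': "xs ! Suc (b' - 1) \<noteq> xs ! (b' - 1)" using moving[OF up(2), of "b' - 1"] ends by simp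
    have "int (xs ! Suc j) - int (xs ! j) = d" if "a \<le> j" "j < b'" for j
    proof -
      have "int (xs ! Suc j) - int (xs ! j) = int (xs ! Suc a) - int (xs ! a)"
      proof (rule stage[OF that(1) _ _ _ ne ne'])
        show "K a = K (Suc (b' - 1))" using const[OF up(2)] m(3) ends by simp
      qed (use ends that in auto)
      then show ?thesis using da by simp
    qed
    then have "\<forall>j\<in>{a..<max b b'}. int (xs ! Suc j) - int (xs ! j) = d"
      using d(2) by (auto simp: less_max_iff_disj)
    then have big: "unit_progression xs a (max b b')"
      unfolding unit_progression_def using ends d(1) by (auto simp: less_max_iff_disj)
    have "{a..b} \<subseteq> {a..max b b'}" "{a'..b'} \<subseteq> {a..max b b'}" using le by auto
    moreover have "\<And>c d. unit_progression xs c d \<Longrightarrow> {a..b} \<subseteq> {c..d} \<Longrightarrow> c = a \<and> d = b"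
      "\<And>c d. unit_progression xs c d \<Longrightarrow> {a'..b'} \<subseteq> {c..d} \<Longrightarrow> c = a' \<and> d = b'"
      using m(1,2) unfolding moves_def mem_Collect_eq prod.case by iprover+
    ultimately show ?thesis using big by metis
  qed
  have "inj_on (K \<circ> fst) (moves xs)"
  proof (rule inj_onI)
    fix x y assume "x \<in> moves xs" "y \<in> moves xs" "(K \<circ> fst) x = (K \<circ> fst) y"
    then show "x = y"
      using merge[of "fst x" "snd x" "fst y" "snd y"] merge[of "fst y" "snd y" "fst x" "snd x"]
      by (metis comp_apply linear prod.collapse)
  qed
  moreover have "(K \<circ> fst) ` moves xs \<subseteq> {..<N}"
  proof
    fix y assume "y \<in> (K \<circ> fst) ` moves xs"
    then obtain a b where "y = K a" "unit_progression xs a b" by (auto simp: moves_def)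
    then show "y \<in> {..<N}" using bound[of a] by (simp add: unit_progression_def)
  qed
  ultimately have "card (moves xs) \<le> card {..<N}"
    by (intro card_inj_on_le[where f = "K \<circ> fst"]) auto
  then show ?thesis by simp
qed

section \<open>The unfolded interval\<close>

text \<open>The circle of length \<open>2n\<close> is unrolled to the integers. Passing a wall takes one step during
  which the position does not change: \<open>n\<close> and \<open>n + 1\<close> both lie over \<open>n\<close>, and \<open>0\<close> and \<open>1\<close> over \<open>1\<close>.\<close>

definition zigzag :: "int \<Rightarrow> int \<Rightarrow> int" where
  "zigzag n \<theta> = (if even ((\<theta> - 1) div n) then (\<theta> - 1) mod n + 1 else n - (\<theta> - 1) mod n)"

context
  fixes n :: int
  assumes n: "n \<ge> 1"
begin

lemma zigzag_eqI:
  assumes "\<theta> = q * n + r" "1 \<le> r" "r \<le> n"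
  shows "zigzag n \<theta> = (if even q then r else n + 1 - r)" "(\<theta> - 1) div n = q"
proof -
  have "\<theta> - 1 = q * n + (r - 1)" using assms by simp
  moreover have "(q * n + (r - 1)) div n = q" "(q * n + (r - 1)) mod n = r - 1"
    using assms by simp_all
  ultimately have "(\<theta> - 1) div n = q \<and> (\<theta> - 1) mod n = r - 1"
    by (simp only:)
  then show "zigzag n \<theta> = (if even q then r else n + 1 - r)" "(\<theta> - 1) div n = q"
    by (auto simp: zigzag_def)
qed

lemma zigzag_cases:
  obtains q r where "\<theta> = q * n + r" "1 \<le> r" "r \<le> n"
proof
  show "\<theta> = ((\<theta> - 1) div n) * n + ((\<theta> - 1) mod n + 1)" by simp
  show "1 \<le> (\<theta> - 1) mod n + 1" "(\<theta> - 1) mod n + 1 \<le> n"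
    using n pos_mod_bound[of n "\<theta> - 1"] pos_mod_sign[of n "\<theta> - 1"] by linarith+
qed

lemma zigzag_range: "1 \<le> zigzag n \<theta>" "zigzag n \<theta> \<le> n"
  by (cases \<theta> rule: zigzag_cases; simp add: zigzag_eqI)+

text \<open>The reflection turns (q, r) into (2k - q - 1, n + 1 - r), so the parity of the lap flips
  together with the remainder. Two such reflections compose to a translation, whence the period
  2n.\<close>

lemma zigzag_reflect: "zigzag n (2 * n * k + 1 - \<theta>) = zigzag n \<theta>"
proof (cases \<theta> rule: zigzag_cases)
  case (1 q r)
  have "2 * n * k + 1 - \<theta> = (2 * k - q - 1) * n + (n + 1 - r)"
    using 1 by (simp add: algebra_simps)
  from zigzag_eqI(1)[OF this] zigzag_eqI(1)[OF 1] 1 show ?thesis by auto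
qed

lemma zigzag_step:
  "zigzag n (\<theta> + 1) - zigzag n \<theta> =
     (if \<theta> div n = (\<theta> - 1) div n then if even ((\<theta> - 1) div n) then 1 else - 1 else 0)"
proof (cases \<theta> rule: zigzag_cases)
  case (1 q r)
  show ?thesis
  proof (cases "r = n")
    case True
    have "\<theta> + 1 = (q + 1) * n + 1" using 1 True by (simp add: algebra_simps)
    from zigzag_eqI[OF this] zigzag_eqI[OF 1] True n show ?thesis by auto
  next
    case False
    have "\<theta> + 1 = q * n + (r + 1)" using 1 by simp
    from zigzag_eqI[OF this] zigzag_eqI[OF 1] False 1 show ?thesis by auto
  qed
qed

lemma zigzag_lipschitz: "\<bar>zigzag n \<theta> - zigzag n \<eta>\<bar> \<le> \<bar>\<theta> - \<eta>\<bar>"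
proof -
  have *: "\<bar>zigzag n (\<eta> + int k) - zigzag n \<eta>\<bar> \<le> int k" for k \<eta>
  proof (induction k)
    case (Suc k)
    have "\<bar>zigzag n (\<eta> + int k + 1) - zigzag n (\<eta> + int k)\<bar> \<le> 1"
      by (simp add: zigzag_step)
    with Suc show ?case by (simp add: algebra_simps)
  qed simp
  show ?thesis
    using *[of \<eta> "nat (\<theta> - \<eta>)"] *[of \<theta> "nat (\<eta> - \<theta>)"] by (cases "\<theta> \<ge> \<eta>") auto
qed

text \<open>Laps of equal parity force equal remainders, hence a translation; laps of opposite
  parity force remainders with sum n + 1, hence a reflection.\<close>

lemma zigzag_eqD:
  assumes "zigzag n \<theta> = zigzag n \<eta>"
  shows "2 * n dvd \<theta> - \<eta> \<or> 2 * n dvd \<theta> + \<eta> - 1"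
proof (cases \<theta> rule: zigzag_cases)
  case (1 q r)
  show ?thesis
  proof (cases \<eta> rule: zigzag_cases)
    case 2: (1 q' r')
    show ?thesis
    proof (cases "even q = even q'")
      case True
      then have "even (q - q')" by simp
      then obtain k where "q - q' = 2 * k" by (rule evenE)
      moreover have "r = r'" using assms True zigzag_eqI(1)[OF 1] zigzag_eqI(1)[OF 2] by (auto split: if_splits)
      moreover have "\<theta> - \<eta> = (q - q') * n + (r - r')" using 1 2 by (simp add: algebra_simps)
      ultimately have "\<theta> - \<eta> = 2 * n * k" by simp
      then show ?thesis by simp
    next
      case False
      then have "even (q + q' + 1)" by auto
      then obtain k where k: "q + q' + 1 = 2 * k" by (rule evenE)
      have "r + r' = n + 1" using assms False zigzag_eqI(1)[OF 1] zigzag_eqI(1)[OF 2] by (auto split: if_splits)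
      then have "\<theta> + \<eta> - 1 = (q + q' + 1) * n" using 1 2 by (simp add: algebra_simps)
      then have "\<theta> + \<eta> - 1 = 2 * n * k" using k by simp
      then show ?thesis by simp
    qed
  qed
qed

end

section \<open>The conveyor belt\<close>

locale belt =
  fixes n :: nat and P :: "nat set"
  assumes n: "n \<ge> 1"
begin

definition rights :: "nat \<Rightarrow> int" where
  "rights p = int (card (P \<inter> {1..p}))"

lemma rights_0: "rights 0 = 0"
  by (simp add: rights_def)

lemma rights_Suc: "rights (Suc p) = rights p + (if Suc p \<in> P then 1 else 0)"
  by (simp add: rights_def atLeastAtMostSuc_conv)

lemma rights_diff:
  assumes "p \<le> q" shows "rights p \<le> rights q" "rights q - rights p \<le> int q - int p"
  using assms by (induction q rule: dec_induct) (auto simp: rights_Suc)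

lemma rights_less:
  assumes "p < q" "q \<in> P" shows "rights p < rights q"
  using rights_diff(1)[of p "q - 1"] rights_Suc[of "q - 1"] assms by simp

lemma rights_less':
  assumes "p < q" "q \<notin> P" shows "rights q - rights p < int q - int p"
  using rights_diff(2)[of p "q - 1"] rights_Suc[of "q - 1"] assms by (cases q) auto

text \<open>Token \<open>p\<close> departs at time \<open>- lead p\<close>. In the walk that goes up at right-starting and down at
  left-starting positions, \<open>lead p\<close> is the larger of the heights before and after step \<open>p\<close>.\<close>

definition lead :: "nat \<Rightarrow> int" where
  "lead p = 2 * rights p - int p + (if p \<in> P then 0 else 1)"

text \<open>The phase 1 - p is the mirror image of p: it lies over the same position, but on the
  lower half, where growing phase means moving left.\<close>

definition start :: "nat \<Rightarrow> int" where
  "start p = (if p \<in> P then int p else 1 - int p)"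

definition clock :: "nat \<Rightarrow> int \<Rightarrow> int" where
  "clock p t = max 0 (min (2 * int n) (t + lead p))"

definition phase :: "nat \<Rightarrow> int \<Rightarrow> int" where
  "phase p t = start p + clock p t"

definition place :: "nat \<Rightarrow> int \<Rightarrow> int" where
  "place p t = zigzag (int n) (phase p t)"

text \<open>The number of walls passed so far; a left-starting token begins on the lower half of the circle,
  one wall earlier.\<close>

definition leg :: "nat \<Rightarrow> int \<Rightarrow> int" where
  "leg p t = (phase p t - 1) div int n + (if p \<in> P then 0 else 1)"

lemma int_n: "int n \<ge> 1"
  using n by simp

text \<open>Leads are heights of a walk with unit steps. Only if p < q with p left-starting and q
  right-starting are they q - p + 1 steps apart, and then the first and last of these steps
  cancel.\<close>

lemma lead_lipschitz: "\<bar>lead p - lead q\<bar> \<le> \<bar>int p - int q\<bar>"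
proof -
  have *: "\<bar>lead p - lead q\<bar> \<le> int q - int p" if "p < q" for p q
  proof (cases "q \<in> P")
    case True
    then show ?thesis using rights_diff[of p q] rights_less[of p q] that
      by (auto simp: lead_def)
  next
    case False
    then show ?thesis using rights_diff[of p q] rights_less'[of p q] that
      by (auto simp: lead_def)
  qed
  show ?thesis using *[of p q] *[of q p] by (cases p q rule: linorder_cases) auto
qed

text \<open>This fixes the time span: at time -n no token has moved yet, and at time 3n all have
  arrived.\<close>

lemma lead_bounds:
  assumes "p \<in> {1..n}" shows "lead p \<le> int n" "lead p > - int n"
proof -
  have "rights 0 \<le> rights p" "rights p - rights 0 \<le> int p" using rights_diff[of 0 p] by auto
  moreover have "p \<in> P \<Longrightarrow> rights 0 < rights p" "p \<notin> P \<Longrightarrow> rights p - rights 0 < int p"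
    using rights_less[of 0 p] rights_less'[of 0 p] assms by auto
  ultimately show "lead p \<le> int n" "lead p > - int n"
    using assms by (auto simp: lead_def rights_0)
qed

lemma zigzag_start:
  assumes "p \<in> {1..n}"
  shows "zigzag (int n) (start p) = int p" "zigzag (int n) (start p + 2 * int n) = int p"
proof -
  have p: "zigzag (int n) (int p) = int p"
    using zigzag_eqI(1)[OF int_n, of "int p" 0 "int p"] assms by simp
  have period: "zigzag (int n) (\<theta> + 2 * int n) = zigzag (int n) \<theta>" for \<theta>
    using zigzag_reflect[OF int_n, of 1 "1 - \<theta>"] zigzag_reflect[OF int_n, of 0 \<theta>]
    by (simp add: algebra_simps)
  show "zigzag (int n) (start p) = int p"
    using p zigzag_reflect[OF int_n, of 0 "int p"] by (simp add: start_def)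
  with period show "zigzag (int n) (start p + 2 * int n) = int p" by simp
qed

section \<open>Distinctness of the positions of the tokens\<close>

lemma place_range: "1 \<le> place p t" "place p t \<le> int n"
  using zigzag_range[OF int_n] by (auto simp: place_def)

lemma place_before: "p \<in> {1..n} \<Longrightarrow> t + lead p \<le> 0 \<Longrightarrow> place p t = int p"
  using zigzag_start by (simp add: place_def phase_def clock_def)

lemma place_after: "p \<in> {1..n} \<Longrightarrow> t + lead p \<ge> 2 * int n \<Longrightarrow> place p t = int p"
  using zigzag_start by (simp add: place_def phase_def clock_def)

lemma place_step: "\<bar>place p t - place p (t + 1)\<bar> \<le> 1"
proof -
  have "\<bar>phase p t - phase p (t + 1)\<bar> \<le> 1" by (auto simp: phase_def clock_def)
  with zigzag_lipschitz[OF int_n, of "phase p t" "phase p (t + 1)"]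
  show ?thesis by (simp add: place_def)
qed

text \<open>A moving token cannot have reached a resting one: its time since departure, or until arrival,
  is less than the difference of the leads, hence less than the distance.\<close>

lemma place_ne_idle:
  assumes pq: "p \<in> {1..n}" "q \<in> {1..n}" "p \<noteq> q"
    and idle: "t + lead p < 0 \<or> t + lead p > 2 * int n"
  shows "place p t \<noteq> place q t"
proof
  assume eq: "place p t = place q t"
  have p: "place p t = int p" using idle place_before place_after pq by force
  consider "t + lead q \<le> 0 \<or> t + lead q \<ge> 2 * int n"
    | "t + lead p < 0" "0 < t + lead q" "t + lead q < 2 * int n"
    | "t + lead p > 2 * int n" "0 < t + lead q" "t + lead q < 2 * int n"
    using idle by linarith
  then show False
  proof cases
    case 1
    then have "place q t = int q" using place_before place_after pq by blast
    then show False using p eq pq by simp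
  next
    case 2
    have "\<bar>int p - int q\<bar> \<le> t + lead q"
      using zigzag_lipschitz[OF int_n, of "phase q t" "start q"] zigzag_start(1)[OF pq(2)] 2 p eq
      by (simp add: place_def phase_def clock_def)
    then show False using lead_lipschitz[of p q] 2 by linarith
  next
    case 3
    have "\<bar>int p - int q\<bar> \<le> 2 * int n - (t + lead q)"
      using zigzag_lipschitz[OF int_n, of "phase q t" "start q + 2 * int n"]
        zigzag_start(2)[OF pq(2)] 3 p eq
      by (simp add: place_def phase_def clock_def)
    then show False using lead_lipschitz[of p q] 3 by linarith
  qed
qed

lemma place_inj:
  assumes pq: "p \<in> {1..n}" "q \<in> {1..n}" and eq: "place p t = place q t"
  shows "p = q"
proof (rule ccontr)
  assume ne: "p \<noteq> q"
  \<comment> \<open>Moving tokens occupy phases of the same parity, so none is the mirror image of another.\<close>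
  define c where "c p = (if p \<in> P then 2 * rights p else 2 * (rights p - int p + 1))" for p
  have active: "0 \<le> t + lead p" "t + lead p \<le> 2 * int n" "0 \<le> t + lead q" "t + lead q \<le> 2 * int n"
    using place_ne_idle[of p q t] place_ne_idle[of q p t] pq ne eq by force+
  then have ph: "phase p t = c p + t" "phase q t = c q + t"
    by (auto simp: phase_def clock_def start_def lead_def c_def)
  \<comment> \<open>In order of position, right-starting tokens get the values 2, 4, 6, ... and
    left-starting ones 0, -2, -4, .... Together these are n consecutive even numbers, hence distinct
    modulo 2n.\<close>
  have bounds: "c p \<noteq> c q \<and> \<bar>c p - c q\<bar> < 2 * int n" if "p < q" "p \<in> {1..n}" "q \<in> {1..n}" for p q
  proof -
    have "q \<in> P \<Longrightarrow> rights p < rights q" "q \<notin> P \<Longrightarrow> rights q - rights p < int q - int p"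
      "rights p \<le> rights q" "rights q - rights p \<le> int q - int p"
      "rights q \<le> rights n" "rights n - rights q \<le> int n - int q"
      "p \<in> P \<Longrightarrow> 0 < rights p" "p \<notin> P \<Longrightarrow> rights p < int p" "0 \<le> rights p" "rights p \<le> int p"
      using rights_less[of p q] rights_less'[of p q] rights_diff[of p q] rights_diff[of q n]
        rights_less[of 0 p] rights_less'[of 0 p] rights_diff[of 0 p] rights_0 that by auto
    moreover have "int q \<le> int n" using that by simp
    ultimately show ?thesis using that by (cases "p \<in> P"; cases "q \<in> P") (auto simp: c_def)
  qed
  have "c p \<noteq> c q" "\<bar>c p - c q\<bar> < 2 * int n"
    using bounds[of p q] bounds[of q p] pq ne by (cases p q rule: linorder_cases; auto)+
  moreover have "2 * int n dvd c p - c q \<or> 2 * int n dvd c p + c q + 2 * t - 1"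
    using zigzag_eqD[OF int_n, of "phase p t" "phase q t"] eq unfolding place_def ph
    by (simp add: algebra_simps)
  moreover have "\<not> 2 * int n dvd c p + c q + 2 * t - 1"
  proof
    assume "2 * int n dvd c p + c q + 2 * t - 1"
    then have "2 dvd c p + c q + 2 * t - 1" by (rule dvd_mult_left)
    moreover have "even (c p)" "even (c q)" by (auto simp: c_def)
    ultimately show False by simp
  qed
  ultimately show False using dvd_imp_le_int[of "c p - c q" "2 * int n"] by auto
qed

text \<open>The time at which \<open>u \<in> P\<close> and \<open>v \<notin> P\<close> first cross; the second crossing is \<open>n\<close> steps later.\<close>

definition meet :: "nat \<Rightarrow> nat \<Rightarrow> int" where
  "meet u v = int v - 1 - rights v - rights u + (if u < v then 0 else int n)"

text \<open>Mirror images have phases with sum 2qn + 1. By parity, travelling tokens skip this sum: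
  they cross between sum 2qn, whose solution for the time is \<open>t\<close>, and sum 2qn + 2. The
  windows say that the crossings fall into the first and second half of either journey.\<close>

lemma meet_phase:
  assumes u: "u \<in> {1..n}" "u \<in> P" and v: "v \<in> {1..n}" "v \<notin> P" and s: "s \<in> {0, 1}"
  defines "t \<equiv> meet u v + s * int n"
  obtains q r where "phase u t = q * int n + r" "phase v t = q * int n - r"
    "1 \<le> r" "r < int n" "s * int n \<le> t + lead u" "t + lead u < (s + 1) * int n"
    "s * int n \<le> t + lead v" "t + lead v < (s + 1) * int n"
proof -
  \<comment> \<open>This is the number of walls passed: tokens that set off facing each other cross
    before any wall, others after one wall each; the second crossing comes one wall later.\<close>
  define q where "q = (if u < v then 0 else 1) + s"
  define r where "r = int v - 1 - rights v + rights u"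
  have facts: "0 < rights u" "rights v < int v"
    "u < v \<Longrightarrow> rights u \<le> rights v \<and> rights v - rights u < int v - int u"
    "v < u \<Longrightarrow> rights v < rights u \<and> rights u - rights v \<le> int u - int v"
    "u \<noteq> v" "int u \<le> int n" "int v \<le> int n" "1 \<le> int u" "1 \<le> int v"
    using rights_less[of 0 u] rights_less'[of 0 v] rights_0 rights_diff[of u v] rights_less'[of u v]
      rights_diff[of v u] rights_less[of v u] u v by auto
  have lead: "t + lead u = q * int n + r - int u" "t + lead v = q * int n - r - 1 + int v"
    using u v by (auto simp: t_def meet_def lead_def q_def r_def algebra_simps)
  have r: "1 \<le> r" "r < int n"
    using facts by (cases u v rule: linorder_cases; auto simp: r_def)+
  have win: "s * int n \<le> t + lead u" "t + lead u < (s + 1) * int n"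
    "s * int n \<le> t + lead v" "t + lead v < (s + 1) * int n"
    unfolding lead q_def r_def using facts
    by (cases u v rule: linorder_cases; simp add: algebra_simps)+
  have "0 \<le> s * int n" "(s + 1) * int n \<le> 2 * int n" using s by auto
  then have "clock u t = t + lead u" "clock v t = t + lead v" using win by (auto simp: clock_def)
  then have "phase u t = q * int n + r" "phase v t = q * int n - r"
    using u v by (auto simp: phase_def start_def lead)
  with r win show thesis using that by blast
qed

text \<open>The rider of \<open>u\<close> stays in place if it changes to \<open>v\<close> after time \<open>t\<close>.\<close>

definition exchange :: "nat \<Rightarrow> nat \<Rightarrow> int \<Rightarrow> bool" where
  "exchange u v t \<longleftrightarrow> place v (t + 1) = place u t \<and> leg v (t + 1) = leg u t"

lemma meet_exchange:
  assumes u: "u \<in> {1..n}" "u \<in> P" and v: "v \<in> {1..n}" "v \<notin> P" and s: "s \<in> {0, 1}"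
  defines "t \<equiv> meet u v + s * int n"
  shows "exchange u v t" "exchange v u t"
proof -
  obtain q r where *: "phase u t = q * int n + r" "phase v t = q * int n - r"
    "1 \<le> r" "r < int n" "s * int n \<le> t + lead u" "t + lead u < (s + 1) * int n"
    "s * int n \<le> t + lead v" "t + lead v < (s + 1) * int n"
    unfolding t_def using meet_phase[OF u v s] by metis
  have "0 \<le> s * int n" "(s + 1) * int n \<le> 2 * int n" using s by auto
  then have "0 \<le> t + lead u" "t + lead u < 2 * int n" "0 \<le> t + lead v" "t + lead v < 2 * int n"
    using * by linarith+
  then have "clock u (t + 1) = clock u t + 1" "clock v (t + 1) = clock v t + 1"
    by (auto simp: clock_def)
  then have ph: "phase u (t + 1) = q * int n + (r + 1)" "phase v (t + 1) = (q - 1) * int n + (int n - r + 1)"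
    "phase u t = q * int n + r" "phase v t = (q - 1) * int n + (int n - r)"
    using * by (auto simp: phase_def algebra_simps)
  \<comment> \<open>If only one of the two tokens advances, the sum 2qn becomes 2qn + 1, which is
    the mirror condition.\<close>
  have "phase v (t + 1) = 2 * int n * q + 1 - phase u t" "phase u (t + 1) = 2 * int n * q + 1 - phase v t"
    unfolding ph by (simp_all add: algebra_simps)
  then have "place v (t + 1) = place u t" "place u (t + 1) = place v t"
    by (simp_all add: place_def zigzag_reflect[OF int_n])
  moreover have "leg u t = q" "leg u (t + 1) = q" "leg v t = q" "leg v (t + 1) = q"
    using ph[THEN zigzag_eqI(2)[OF int_n]] * u v by (auto simp: leg_def)
  ultimately show "exchange u v t" "exchange v u t" by (simp_all add: exchange_def)
qed

section \<open>The three legs of a token\<close>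

lemma leg_bounds:
  assumes "p \<in> {1..n}" shows "0 \<le> leg p t" "leg p t \<le> 2"
proof -
  have "0 \<le> clock p t" "clock p t \<le> 2 * int n" by (auto simp: clock_def)
  then have "p \<in> P \<Longrightarrow> 0 \<le> phase p t - 1 \<and> phase p t - 1 < 3 * int n"
    "p \<notin> P \<Longrightarrow> - int n \<le> phase p t - 1 \<and> phase p t - 1 < 2 * int n"
    using assms by (auto simp: phase_def start_def)
  moreover have "- 1 \<le> x div int n \<and> x div int n \<le> 2 \<and> (0 \<le> x \<longrightarrow> 0 \<le> x div int n) \<and>
      (x < 2 * int n \<longrightarrow> x div int n \<le> 1)" if "- int n \<le> x" "x < 3 * int n" for x
  proof -
    have "- int n div int n = - 1" "(3 * int n - 1) div int n = 2" "(2 * int n - 1) div int n = 1"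
      using zigzag_eqI(2)[OF int_n, of "1 - int n" "- 1" 1] zigzag_eqI(2)[OF int_n, of "3 * int n" 2 "int n"]
        zigzag_eqI(2)[OF int_n, of "2 * int n" 1 "int n"] int_n by simp_all
    then show ?thesis
      using zdiv_mono1[of "- int n" x "int n"] zdiv_mono1[of 0 x "int n"]
        zdiv_mono1[of x "3 * int n - 1" "int n"] zdiv_mono1[of x "2 * int n - 1" "int n"] that int_n
      by auto
  qed
  from this[of "phase p t - 1"] calculation show "0 \<le> leg p t" "leg p t \<le> 2"
    using int_n by (auto simp: leg_def)
qed

lemma leg_mono: "s \<le> t \<Longrightarrow> leg p s \<le> leg p t"
proof -
  assume "s \<le> t"
  then have "phase p s - 1 \<le> phase p t - 1" by (auto simp: phase_def clock_def)
  then show ?thesis using zdiv_mono1 int_n by (auto simp: leg_def)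
qed

text \<open>Every wall turns a token around, so colour and parity of the leg determine its
  direction; the step on which the leg grows is spent passing the wall.\<close>

lemma place_step_leg:
  "place p (t + 1) - place p t =
    (if 0 \<le> t + lead p \<and> t + lead p < 2 * int n \<and> leg p (t + 1) = leg p t
     then if even (leg p t) = (p \<in> P) then 1 else - 1 else 0)"
proof (cases "0 \<le> t + lead p \<and> t + lead p < 2 * int n")
  case True
  then have "phase p (t + 1) = phase p t + 1" by (auto simp: phase_def clock_def)
  then show ?thesis using zigzag_step[OF int_n, of "phase p t"] True
    by (auto simp: place_def leg_def)
next
  case False
  then have "phase p (t + 1) = phase p t" by (auto simp: phase_def clock_def)
  then show ?thesis using False by (auto simp: place_def)
qed

text \<open>For a fixed point of \<open>f\<close> the value is an arbitrary time in the window of \<open>switch_window\<close>.\<close>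

definition switch :: "(nat \<Rightarrow> nat) \<Rightarrow> int \<Rightarrow> nat \<Rightarrow> int" where
  "switch f s x = s * int n +
     (if f x = x then - lead x else if x \<in> P then meet x (f x) else meet (f x) x)"

text \<open>The comparison is strict because a change at time t takes effect at t + 1, as in
  \<open>exchange\<close>.\<close>

definition swapped :: "(nat \<Rightarrow> nat) \<Rightarrow> int \<Rightarrow> int \<Rightarrow> nat \<Rightarrow> nat" where
  "swapped f s t x = (if switch f s x < t then f x else x)"

context
  fixes f :: "nat \<Rightarrow> nat" and s :: int
  assumes f: "alternating_involution {1..n} P f" and s: "s \<in> {0, 1}"
begin

text \<open>Measured from the departure of x, the changes for \<open>s = 0\<close> and
  \<open>s = 1\<close> lie in disjoint successive windows. This puts those of \<open>a\<close>
  before those of \<open>b\<close> on every token.\<close>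

lemma switch_window:
  assumes x: "x \<in> {1..n}"
  shows "s * int n \<le> switch f s x + lead x" "switch f s x + lead x < (s + 1) * int n"
proof -
  have "s * int n \<le> switch f s x + lead x \<and> switch f s x + lead x < (s + 1) * int n"
  proof (cases "f x = x")
    case True
    then show ?thesis using n by (simp add: switch_def algebra_simps)
  next
    case False
    then have fx: "f x \<in> {1..n}" "f (f x) = x" "(f x \<in> P) \<noteq> (x \<in> P)"
      using f x by (auto simp: alternating_involution_def)
    show ?thesis
    proof (cases "x \<in> P")
      case True
      with False meet_phase[OF x True fx(1) _ s] fx(3) show ?thesis
        by (auto simp: switch_def add.commute)
    next
      case 2: False
      with False meet_phase[OF fx(1) _ x 2 s] fx(3) show ?thesis
        by (auto simp: switch_def add.commute)
    qed
  qed
  then show "s * int n \<le> switch f s x + lead x" "switch f s x + lead x < (s + 1) * int n" by auto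
qed

lemma switch_exchange:
  assumes x: "x \<in> {1..n}" and ne: "f x \<noteq> x"
  shows "exchange x (f x) (switch f s x)"
proof -
  have fx: "f x \<in> {1..n}" "f (f x) = x" "(f x \<in> P) \<noteq> (x \<in> P)"
    using f x ne by (auto simp: alternating_involution_def)
  show ?thesis
  proof (cases "x \<in> P")
    case True
    with ne meet_exchange(1)[OF x True fx(1) _ s] fx(3) show ?thesis
      by (auto simp: switch_def add.commute)
  next
    case False
    with ne meet_exchange(2)[OF fx(1) _ x False s] fx(3) show ?thesis
      by (auto simp: switch_def add.commute)
  qed
qed

lemma switch_partner: "x \<in> {1..n} \<Longrightarrow> switch f s (f x) = switch f s x"
  using f by (auto simp: switch_def alternating_involution_def)

lemma swapped_in: "x \<in> {1..n} \<Longrightarrow> swapped f s t x \<in> {1..n}"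
  using f by (auto simp: swapped_def alternating_involution_def)

lemma swapped_swapped: "x \<in> {1..n} \<Longrightarrow> swapped f s t (swapped f s t x) = x"
  using f switch_partner by (auto simp: swapped_def alternating_involution_def)

end
end

section \<open>Riders on the belt\<close>

locale bouncing_belt = belt +
  fixes a b :: "nat \<Rightarrow> nat"
  assumes a: "alternating_involution {1..n} P a" and b: "alternating_involution {1..n} P b"
begin

text \<open>The token ridden at time t by the element that begins on token x.\<close>

definition line :: "int \<Rightarrow> nat \<Rightarrow> nat" where
  "line t x = swapped b 1 t (swapped a 0 t x)"

lemma line_in: "x \<in> {1..n} \<Longrightarrow> line t x \<in> {1..n}"
  using swapped_in[OF a] swapped_in[OF b] by (simp add: line_def)

lemma line_inj:
  assumes "x \<in> {1..n}" "y \<in> {1..n}" "line t x = line t y" shows "x = y"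
  using assms swapped_in[OF a, of 0] swapped_swapped[OF a, of 0] swapped_swapped[OF b, of 1]
  unfolding line_def by (metis insertI1 insertI2)

lemma line_step:
  assumes x: "x \<in> {1..n}" and ne: "line (t + 1) x \<noteq> line t x"
  shows "exchange (line t x) (line (t + 1) x) t" "t \<in> {switch a 0 x, switch b 1 (a x)}"
proof -
  have ax: "a x \<in> {1..n}" "switch a 0 (a x) = switch a 0 x"
    using a switch_partner[OF a] x by (auto simp: alternating_involution_def)
  \<comment> \<open>This includes fixed points, whose default times lie in the same windows. So a
    rider that meets its \<open>b\<close>-change has its \<open>a\<close>-change behind it.\<close>
  have early: "switch a 0 y < switch b 1 y" if "y \<in> {1..n}" for y
    using switch_window(2)[OF a _ that, of 0] switch_window(1)[OF b _ that, of 1] by simp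
  have "exchange (line t x) (line (t + 1) x) t \<and> t \<in> {switch a 0 x, switch b 1 (a x)}"
  proof (cases "switch a 0 x = t")
    case True
    then have "line t x = x" "line (t + 1) x = a x"
      using early[OF x] early[OF ax(1)] ax(2) by (auto simp: line_def swapped_def)
    then show ?thesis using switch_exchange[OF a _ x, of 0] ne True by auto
  next
    case False
    define y where "y = swapped a 0 t x"
    have y: "y \<in> {1..n}" using swapped_in[OF a _ x] by (simp add: y_def)
    have *: "line t x = swapped b 1 t y" "line (t + 1) x = swapped b 1 (t + 1) y"
      using False by (auto simp: line_def swapped_def y_def)
    then have t: "switch b 1 y = t" using ne by (auto simp: swapped_def split: if_splits)
    then have "line t x = y" "line (t + 1) x = b y" unfolding * by (simp_all add: swapped_def)
    moreover have "y = a x"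
      using t early[OF x] by (auto simp: y_def swapped_def split: if_splits)
    ultimately show ?thesis using switch_exchange[OF b _ y, of 1] ne t by auto
  qed
  then show "exchange (line t x) (line (t + 1) x) t" "t \<in> {switch a 0 x, switch b 1 (a x)}"
    by auto
qed

lemma line_begin: "x \<in> {1..n} \<Longrightarrow> line (- int n) x = x"
  using switch_window(1)[OF a, of 0 x] switch_window(1)[OF b, of 1 x] lead_bounds(1)[of x]
  by (auto simp: line_def swapped_def)

lemma line_end:
  assumes x: "x \<in> {1..n}" shows "line (3 * int n) x = b (a x)"
proof -
  have ax: "a x \<in> {1..n}" using a x by (simp add: alternating_involution_def)
  then show ?thesis
    using switch_window(2)[OF a _ x, of 0] switch_window(2)[OF b _ ax, of 1] lead_bounds(2)[OF x]
      lead_bounds(2)[OF ax] by (auto simp: line_def swapped_def)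
qed

text \<open>Index 0 stands for time -n, when every token is still at its resting position.\<close>

definition pos :: "nat \<Rightarrow> nat \<Rightarrow> nat" where
  "pos k x = (if x \<in> {1..n} then nat (place (line (int k - int n) x) (int k - int n)) else x)"

lemma int_pos: "x \<in> {1..n} \<Longrightarrow> int (pos k x) = place (line (int k - int n) x) (int k - int n)"
  using place_range(1)[of "line (int k - int n) x" "int k - int n"] by (simp add: pos_def)

lemma pos_permutes: "pos k permutes {1..n}"
proof (rule bij_imp_permutes)
  have "inj_on (pos k) {1..n}"
  proof (rule inj_onI)
    fix x y assume xy: "x \<in> {1..n}" "y \<in> {1..n}" "pos k x = pos k y"
    then have "place (line (int k - int n) x) (int k - int n) = place (line (int k - int n) y) (int k - int n)"
      using int_pos by metis
    then show "x = y" using place_inj line_in line_inj xy by blast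
  qed
  moreover have "pos k ` {1..n} \<subseteq> {1..n}"
  proof
    fix y assume "y \<in> pos k ` {1..n}"
    then obtain x where "x \<in> {1..n}" "y = pos k x" by blast
    then show "y \<in> {1..n}" using int_pos[of x k] place_range[of "line (int k - int n) x" "int k - int n"] by auto
  qed
  ultimately show "bij_betw (pos k) {1..n} {1..n}"
    by (simp add: bij_betw_def endo_inj_surj)
qed (auto simp: pos_def)

lemma pos_step:
  assumes x: "x \<in> {1..n}" shows "\<bar>int (pos k x) - int (pos (Suc k) x)\<bar> \<le> 1"
proof -
  define t where "t = int k - int n"
  have t: "int (Suc k) - int n = t + 1" by (simp add: t_def)
  show ?thesis
    using line_step(1)[OF x, of t] place_step[of "line t x" t]
    unfolding int_pos[OF x] t t_def[symmetric] by (cases "line (t + 1) x = line t x") (auto simp: exchange_def)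
qed

text \<open>A direction can change only at a wall or on a change of tokens. The first raises the
  leg, the second leaves it alone, so the sum of both counts never falls and is at most 2 +
  2.\<close>

definition stage :: "nat \<Rightarrow> nat \<Rightarrow> nat" where
  "stage x k = nat (leg (line (int k - int n) x) (int k - int n)) +
     card {t \<in> {- int n..<int k - int n}. line (t + 1) x \<noteq> line t x}"

lemma stage_less:
  assumes x: "x \<in> {1..n}" shows "stage x k < 5"
proof -
  have "card {t \<in> {- int n..<int k - int n}. line (t + 1) x \<noteq> line t x} \<le>
      card {switch a 0 x, switch b 1 (a x)}"
    using line_step(2)[OF x] by (intro card_mono) auto
  also have "\<dots> \<le> 2" by (simp add: card_insert_if)
  finally show ?thesis using leg_bounds(2)[OF line_in[OF x], of "int k - int n" "int k - int n"]
    by (simp add: stage_def)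
qed

text \<open>A stage ends either at a wall or in an exchange, and both hold the position for that
  step.\<close>

lemma stage_Suc:
  assumes x: "x \<in> {1..n}"
  defines "t k \<equiv> int k - int n"
  shows "stage x k \<le> stage x (Suc k)"
    and "stage x k = stage x (Suc k) \<Longrightarrow>
      line (t (Suc k)) x = line (t k) x \<and> leg (line (t k) x) (t (Suc k)) = leg (line (t k) x) (t k)"
    and "stage x k \<noteq> stage x (Suc k) \<Longrightarrow> pos (Suc k) x = pos k x"
proof -
  have t: "t (Suc k) = t k + 1" by (simp add: t_def)
  define D where "D r = {s \<in> {- int n..<r}. line (s + 1) x \<noteq> line s x}" for r
  have "{- int n..<t (Suc k)} = insert (t k) {- int n..<t k}" by (auto simp: t_def)
  then have "D (t (Suc k)) = (if line (t k + 1) x = line (t k) x then D (t k) else insert (t k) (D (t k)))"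
    by (auto simp: D_def)
  moreover have "finite (D (t k))"
    by (rule finite_subset[of _ "{- int n..<t k}"]) (auto simp: D_def)
  moreover have "t k \<notin> D (t k)" by (simp add: D_def)
  ultimately have "card (D (t (Suc k))) =
      card (D (t k)) + (if line (t k + 1) x = line (t k) x then 0 else 1)"
    by simp
  then have st: "stage x (Suc k) + nat (leg (line (t k) x) (t k)) =
      stage x k + nat (leg (line (t k + 1) x) (t k + 1)) +
      (if line (t k + 1) x = line (t k) x then 0 else 1)"
    unfolding stage_def t_def[symmetric] D_def[symmetric] t by simp
  have leg: "0 \<le> leg (line (t k) x) (t k)" "0 \<le> leg (line (t k + 1) x) (t k + 1)"
    using leg_bounds(1) line_in x by blast+
  have pos: "int (pos k x) = place (line (t k) x) (t k)"
    "int (pos (Suc k) x) = place (line (t k + 1) x) (t k + 1)"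
    unfolding int_pos[OF x] t_def[symmetric] t by simp_all
  have "stage x k \<le> stage x (Suc k) \<and>
    (stage x k = stage x (Suc k) \<longrightarrow>
      line (t k + 1) x = line (t k) x \<and> leg (line (t k) x) (t k + 1) = leg (line (t k) x) (t k)) \<and>
    (stage x k \<noteq> stage x (Suc k) \<longrightarrow> pos (Suc k) x = pos k x)"
  proof (cases "line (t k + 1) x = line (t k) x")
    case True
    define l where "l = line (t k) x"
    have "leg l (t k) \<le> leg l (t k + 1)" by (simp add: leg_mono)
    moreover have "leg l (t k + 1) \<noteq> leg l (t k) \<Longrightarrow> pos (Suc k) x = pos k x"
      using place_step_leg[of l "t k"] pos True unfolding l_def[symmetric] by simp
    ultimately show ?thesis using True st leg unfolding l_def[symmetric] by auto
  next
    case False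
    then show ?thesis using line_step(1)[OF x False] st pos by (simp add: exchange_def)
  qed
  then show "stage x k \<le> stage x (Suc k)"
    "stage x k = stage x (Suc k) \<Longrightarrow>
      line (t (Suc k)) x = line (t k) x \<and> leg (line (t k) x) (t (Suc k)) = leg (line (t k) x) (t k)"
    "stage x k \<noteq> stage x (Suc k) \<Longrightarrow> pos (Suc k) x = pos k x"
    unfolding t by blast+
qed

lemma stage_constant:
  assumes x: "x \<in> {1..n}" and le: "i \<le> j" "j \<le> k" and eq: "stage x i = stage x k"
  shows "line (int j - int n) x = line (int i - int n) x"
    "leg (line (int i - int n) x) (int j - int n) = leg (line (int i - int n) x) (int i - int n)"
proof -
  have mono: "i \<le> j \<Longrightarrow> stage x i \<le> stage x j" for i j
    by (rule lift_Suc_mono_le) (use stage_Suc(1)[OF x] in auto)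
  have "i + d \<le> k \<Longrightarrow> line (int (i + d) - int n) x = line (int i - int n) x \<and>
    leg (line (int i - int n) x) (int (i + d) - int n) = leg (line (int i - int n) x) (int i - int n)" for d
  proof (induction d)
    case (Suc d)
    have "stage x (i + d) = stage x (Suc (i + d))"
      using mono[of i "i + d"] mono[of "i + d" "Suc (i + d)"] mono[of "Suc (i + d)" k] eq Suc by auto
    from stage_Suc(2)[OF x this] Suc show ?case by simp
  qed simp
  from this[of "j - i"] le show "line (int j - int n) x = line (int i - int n) x"
    "leg (line (int i - int n) x) (int j - int n) = leg (line (int i - int n) x) (int i - int n)"
    by auto
qed

lemma stage_direction:
  assumes x: "x \<in> {1..n}" and le: "i \<le> j" "j \<le> k" and eq: "stage x i = stage x (Suc k)"
    and ne: "pos (Suc i) x \<noteq> pos i x" "pos (Suc k) x \<noteq> pos k x"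
  shows "int (pos (Suc j) x) - int (pos j x) = int (pos (Suc i) x) - int (pos i x)"
proof -
  define l where "l = line (int i - int n) x"
  define g where "g = leg l (int i - int n)"
  have *: "int (pos (Suc j) x) - int (pos j x) =
     (if 0 \<le> int j - int n + lead l \<and> int j - int n + lead l < 2 * int n
      then if even g = (l \<in> P) then 1 else - 1 else 0)" if "i \<le> j" "j \<le> k" for j
  proof -
    have "line (int j - int n) x = l" "line (int (Suc j) - int n) x = l"
      "leg l (int j - int n) = g" "leg l (int (Suc j) - int n) = g"
      using stage_constant[OF x _ _ eq, of j] stage_constant[OF x _ _ eq, of "Suc j"] that
      unfolding l_def g_def by auto
    then show ?thesis using place_step_leg[of l "int j - int n"] unfolding int_pos[OF x]
      by (simp add: algebra_simps)
  qed
  \<comment> \<open>The token is under way at steps i and k since the position changes there; its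
    travel time is an interval, so it is under way at step j too.\<close>
  from *[of i] *[of j] *[of k] le ne show ?thesis by (auto split: if_splits)
qed

lemma card_moves_pos:
  assumes x: "x \<in> {1..n}"
  shows "card (moves (map (\<lambda>k. pos k x) [0..<m])) \<le> 5"
proof (rule card_moves_le[where K = "stage x"])
  fix k assume "Suc k < length (map (\<lambda>k. pos k x) [0..<m])" "stage x k \<noteq> stage x (Suc k)"
  then show "map (\<lambda>k. pos k x) [0..<m] ! Suc k = map (\<lambda>k. pos k x) [0..<m] ! k"
    using stage_Suc(3)[OF x] by (simp del: upt_Suc)
next
  fix i j k
  assume "i \<le> j" "j \<le> k" "Suc k < length (map (\<lambda>k. pos k x) [0..<m])" "stage x i = stage x (Suc k)"
    "map (\<lambda>k. pos k x) [0..<m] ! Suc i \<noteq> map (\<lambda>k. pos k x) [0..<m] ! i"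
    "map (\<lambda>k. pos k x) [0..<m] ! Suc k \<noteq> map (\<lambda>k. pos k x) [0..<m] ! k"
  then show "int (map (\<lambda>k. pos k x) [0..<m] ! Suc j) - int (map (\<lambda>k. pos k x) [0..<m] ! j) =
      int (map (\<lambda>k. pos k x) [0..<m] ! Suc i) - int (map (\<lambda>k. pos k x) [0..<m] ! i)"
    using stage_direction[OF x, of i j k] by (simp del: upt_Suc)
qed (use stage_less[OF x] in auto)

end

section \<open>Assembling the tangle\<close>

theorem theorem1:
  fixes n :: nat and \<pi> :: "nat \<Rightarrow> nat"
  assumes "n \<ge> 1" and "\<pi> permutes {1..n}"
  shows "\<exists>T. performs n T \<pi> \<and> (\<forall>i\<in>{1..n}. card (moves (positions_path T i)) \<le> 5)"
proof -
  \<comment> \<open>The inverse is factored because the belt yields positions: the element x has to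
    end at position \<open>inv \<pi> x\<close>.\<close>
  obtain P a b where ab: "alternating_involution {1..n} P a" "alternating_involution {1..n} P b"
      "\<forall>x\<in>{1..n}. b (a x) = inv \<pi> x"
    using permutes_alternating_involutions[OF permutes_inv[OF assms(2)]] by auto
  interpret bouncing_belt n P a b
    by unfold_locales (use assms ab in auto)
  \<comment> \<open>The 4n + 1 entries cover the times -n to 3n.\<close>
  define T where "T = map (\<lambda>k. inv (pos k)) [0..<Suc (4 * n)]"
  have inv_inv: "inv (inv (pos k)) = pos k" for k
    using permutes_inv_inv[OF pos_permutes] .
  have "tangle n T"
    unfolding tangle_def
  proof (intro conjI ballI allI impI)
    show "p permutes {1..n}" if "p \<in> set T" for p
      using that permutes_inv[OF pos_permutes] by (auto simp: T_def)
    show "adjacent n (T ! k) (T ! Suc k)" if "Suc k < length T" for k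
      using that pos_step by (simp add: T_def adjacent_def inv_inv del: upt_Suc)
  qed (simp add: T_def)
  moreover have "hd T = id"
  proof -
    have "pos 0 = id"
      using line_begin place_before lead_bounds(1) by (fastforce simp: pos_def)
    then show ?thesis by (simp add: T_def upt_conv_Cons del: upt_Suc)
  qed
  moreover have "last T = \<pi>"
  proof -
    have "pos (4 * n) x = inv \<pi> x" for x
    proof (cases "x \<in> {1..n}")
      case True
      then have "inv \<pi> x \<in> {1..n}" using permutes_in_image[OF permutes_inv[OF assms(2)]] by blast
      with place_after lead_bounds(2)[of "inv \<pi> x"] show ?thesis
        using True line_end[OF True] ab(3) by (simp add: pos_def)
    next
      case False
      then show ?thesis using permutes_not_in[OF permutes_inv[OF assms(2)]] by (auto simp: pos_def)
    qed
    then have "pos (4 * n) = inv \<pi>" by blast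
    then show ?thesis using assms(2) by (simp add: T_def inv_inv_eq permutes_bij)
  qed
  moreover have "positions_path T i = map (\<lambda>k. pos k i) [0..<Suc (4 * n)]" for i
    by (simp add: T_def positions_path_def inv_inv del: upt_Suc)
  ultimately show ?thesis using card_moves_pos unfolding performs_def by metis
qed

end
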